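(* Let $L>0$, $n\ge 1$, and let $f(\cdot;1),\dots,f(\cdot;n):\mathbb{R}^d\to\mathbb{R}$ be convex differentiable functions such that $\|\nabla f(x;i)-\nabla f(y;i)\|\le L\|x-y\|$ for all $x,y\in\mathbb{R}^d$ and $i\in\{1,\dots,n\}$. Let $F(w)=\frac1n\sum_{i=1}^n f(w;i)$. Let $E>0$ be a constant, and let $\tilde x_0\in\mathbb{R}^d$ be a (deterministic) point such that there is a minimizer $x_*$ of $F$ with $\|\tilde x_0-x_*\|\le \frac{E}{\sqrt n}$; let $\sigma_*^2=\frac1n\sum_{i=1}^n\|\nabla f(x_*;i)\|^2$. Let $T\ge 2$ be an integer, $\alpha=1+\frac1T$, $k=\frac{1}{e\,\alpha\,\sqrt[3]{12}}$. Run the NASG algorithm for $T$ epochs from the initial point $\tilde y_0=\tilde x_0$ under a randomized scheme (Random Reshuffling or Single Shuffling), with momentum parameters $\gamma_t=\frac{t-1}{t+2}$ and learning rates $\eta_i^{(t)}=\frac{\eta_t}{n}>0$, where $\eta_t=\frac{k\alpha^t}{LT}\le\frac1L$. Then $$\mathbb{E}[F(\tilde x_T)-F(x_* )]\le \frac{8\sigma_*^2}{27nLT}+\frac{2LE^2e\sqrt[3]{12}}{nT}.$$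
   Context: NASG (Nesterov Accelerated Shuffling Gradient) algorithm: given initial points $\tilde x_0,\tilde y_0\in\mathbb{R}^d$, parameters $\gamma_t$ and learning rates $\eta_i^{(t)}>0$, for each epoch $t=1,2,\dots,T$: set $y_0^{(t)}:=\tilde y_{t-1}$; choose a permutation $\pi^{(t)}$ of $\{1,\dots,n\}$; for $i=1,\dots,n$ set $y_i^{(t)}:=y_{i-1}^{(t)}-\eta_i^{(t)}\nabla f(y_{i-1}^{(t)};\pi^{(t)}(i))$; then set $\tilde x_t:=y_n^{(t)}$ and $\tilde y_t:=\tilde x_t+\gamma_t(\tilde x_t-\tilde x_{t-1})$. Randomized schemes: Random Reshuffling means a new uniformly random permutation $\pi^{(t)}$ is drawn independently at the beginning of each epoch; Single Shuffling means a single uniformly random permutation is drawn at the start and used in every epoch. $\mathbb{E}$ is the expectation over the random permutation(s), while $E$ is a real constant; $e$ is Euler's number. *)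

theory Defs
  imports "HOL-Analysis.Analysis" "HOL-Probability.Probability"
begin

text \<open>
  Throughout, \<open>g j x\<close> stands for the gradient of the \<open>j\<close>-th component function at \<open>x\<close>.
  Epochs and component indices are numbered from 1.
\<close>

primrec nasg_inner ::
  "(nat \<Rightarrow> 'a \<Rightarrow> 'a) \<Rightarrow> (nat \<Rightarrow> real) \<Rightarrow> (nat \<Rightarrow> nat) \<Rightarrow> 'a \<Rightarrow> nat \<Rightarrow> 'a::real_vector"
where
  "nasg_inner g \<eta> p y 0 = y"
| "nasg_inner g \<eta> p y (Suc i) =
     nasg_inner g \<eta> p y i - \<eta> (Suc i) *\<^sub>R g (p (Suc i)) (nasg_inner g \<eta> p y i)"

text \<open>
  The state after epoch \<open>t\<close> is the pair of \<open>x\<^sub>t\<close> (the iterate) and \<open>y\<^sub>t\<close> (the extrapolated point).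
  The step size of the \<open>i\<close>-th inner step of epoch \<open>t\<close> is \<open>\<eta> t i\<close>, and \<open>\<pi> t\<close> is the permutation
  used in epoch \<open>t\<close>.
\<close>

primrec nasg_state ::
  "nat \<Rightarrow> (nat \<Rightarrow> 'a \<Rightarrow> 'a) \<Rightarrow> (nat \<Rightarrow> real) \<Rightarrow> (nat \<Rightarrow> nat \<Rightarrow> real) \<Rightarrow> (nat \<Rightarrow> nat \<Rightarrow> nat)
    \<Rightarrow> 'a \<Rightarrow> 'a \<Rightarrow> nat \<Rightarrow> 'a::real_vector \<times> 'a"
where
  "nasg_state n g \<gamma> \<eta> \<pi> x0 y0 0 = (x0, y0)"
| "nasg_state n g \<gamma> \<eta> \<pi> x0 y0 (Suc t) =
     (let (x, y) = nasg_state n g \<gamma> \<eta> \<pi> x0 y0 t;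
          x' = nasg_inner g (\<eta> (Suc t)) (\<pi> (Suc t)) y n
      in (x', x' + \<gamma> (Suc t) *\<^sub>R (x' - x)))"

definition nasg ::
  "nat \<Rightarrow> (nat \<Rightarrow> 'a \<Rightarrow> 'a) \<Rightarrow> (nat \<Rightarrow> real) \<Rightarrow> (nat \<Rightarrow> nat \<Rightarrow> real) \<Rightarrow> (nat \<Rightarrow> nat \<Rightarrow> nat)
    \<Rightarrow> 'a \<Rightarrow> 'a \<Rightarrow> nat \<Rightarrow> 'a::real_vector"
where
  "nasg n g \<gamma> \<eta> \<pi> x0 y0 t = fst (nasg_state n g \<gamma> \<eta> \<pi> x0 y0 t)"

definition uniform_permutation :: "nat \<Rightarrow> (nat \<Rightarrow> nat) pmf" where
  "uniform_permutation n = pmf_of_set {p. p permutes {1..n}}"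

text \<open>
  The two randomized schemes, as joint distributions of the sequence of permutations.  Under
  \<open>random_reshuffling n T\<close> the permutations of epochs \<open>1..T\<close> are independent; outside these
  epochs the sequence has the irrelevant default value \<open>id\<close>.
\<close>

definition random_reshuffling :: "nat \<Rightarrow> nat \<Rightarrow> (nat \<Rightarrow> nat \<Rightarrow> nat) pmf" where
  "random_reshuffling n T = Pi_pmf {1..T} id (\<lambda>_. uniform_permutation n)"

definition single_shuffling :: "nat \<Rightarrow> (nat \<Rightarrow> nat \<Rightarrow> nat) pmf" where
  "single_shuffling n = map_pmf (\<lambda>p _. p) (uniform_permutation n)"

end

theory Submission
  imports Defs
begin

text \<open>
  With \<open>\<theta>\<^sub>t = 2 / (t + 1)\<close> the extrapolation weight is \<open>\<gamma>\<^sub>t = \<theta>\<^bsub>t+1\<^esub> (1 / \<theta>\<^sub>t - 1)\<close>, so the auxiliary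
  points \<open>v\<^sub>t = x\<^sub>t + (y\<^sub>t - x\<^sub>t) / \<theta>\<^bsub>t+1\<^esub>\<close> play their usual role in Nesterov's method.  An epoch is an
  inexact gradient step of length \<open>\<eta>\<^sub>t\<close>.  Its inexactness has a part controlled by the deviations
  \<open>\<nabla>f\<^sub>j(w) - \<nabla>f\<^sub>j(x\<^sub>*)\<close> at the inner iterates, which is absorbed by the quadratic term of cocoercivity
  because \<open>L\<^sup>2 \<eta>\<^sub>t\<^sup>2 \<le> \<theta>\<^sub>t / 2\<close>, and a part involving only the partial sums of the shuffled gradients at
  \<open>x\<^sub>*\<close>.  Since \<open>\<eta>\<close> is nondecreasing, the potential
  \<open>t (t + 2) (F x\<^sub>t - F x\<^sub>*) + (2 / \<eta>\<^bsub>t+1\<^esub>) \<parallel>v\<^sub>t - x\<^sub>*\<parallel>\<^sup>2\<close> grows only by these partial sums.  They depend on one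
  permutation each, so only its uniform marginal law matters, and sampling without
  replacement makes their second moments at most those of independent samples.
\<close>

section \<open>Permuted sums and squared norms of sums\<close>

lemma sum_interval_permutes:
  assumes "p permutes {1..n}"
  shows "(\<Sum>i=1..n. g (p i)) = (\<Sum>i=1..n. g i)"
  using sum.permute[OF assms, of g] by (simp add: o_def)

lemma norm_sum_squared_le:
  fixes a :: "'b \<Rightarrow> 'a::real_inner"
  shows "(norm (\<Sum>i\<in>A. a i))\<^sup>2 \<le> real (card A) * (\<Sum>i\<in>A. (norm (a i))\<^sup>2)"
proof -
  have "(norm (\<Sum>i\<in>A. a i))\<^sup>2 \<le> (\<Sum>i\<in>A. norm (a i))\<^sup>2"
    by (intro power_mono norm_sum) auto
  also have "\<dots> \<le> (\<Sum>i\<in>A. (norm (a i))\<^sup>2) * real (card A)"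
    using Cauchy_Schwarz_ineq_sum[of "\<lambda>_. 1" "\<lambda>i. norm (a i)" A] by (simp add: mult.commute)
  finally show ?thesis by (simp add: mult.commute)
qed

lemma norm_add_squared_le:
  fixes a b :: "'a::real_inner"
  shows "(norm (a + b))\<^sup>2 \<le> 2 * (norm a)\<^sup>2 + 2 * (norm b)\<^sup>2"
proof -
  have "(norm (a + b))\<^sup>2 + (norm (a - b))\<^sup>2 = 2 * (norm a)\<^sup>2 + 2 * (norm b)\<^sup>2"
    by (simp add: power2_norm_eq_inner inner_simps inner_commute)
  then show ?thesis
    using zero_le_power2[of "norm (a - b)"] by linarith
qed

section \<open>Smooth convex functions\<close>

lemma GDERIV_along_line:
  fixes f :: "'a::real_inner \<Rightarrow> real"
  assumes "GDERIV f (y + s *\<^sub>R d) :> D"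
  shows "((\<lambda>s. f (y + s *\<^sub>R d)) has_real_derivative inner D d) (at s)"
proof -
  have "((\<lambda>s. y + s *\<^sub>R d) has_derivative (\<lambda>h. h *\<^sub>R d)) (at s)"
    by (auto intro!: derivative_eq_intros)
  from has_derivative_compose[OF this assms[unfolded gderiv_def]]
  show ?thesis
    unfolding has_field_derivative_def
    by (rule has_derivative_eq_rhs) (simp add: inner_commute mult.commute fun_eq_iff)
qed

text \<open>On the line through \<open>y\<close> and \<open>z\<close> the function is convex in one
  real variable; its tangent at parameter 0 is compared with its value at parameter 1.\<close>

lemma convex_on_GDERIV_above_tangent:
  fixes f :: "'a::real_inner \<Rightarrow> real"
  assumes convex: "convex_on UNIV f" and "GDERIV f y :> D"
  shows "f z \<ge> f y + inner D (z - y)"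
proof -
  let ?h = "\<lambda>s. f (y + s *\<^sub>R (z - y))"
  have D: "(?h has_real_derivative inner D (z - y)) (at 0)"
    by (rule GDERIV_along_line) (use assms in simp)
  have "convex_on UNIV ?h"
  proof (rule convex_onI)
    fix t a b :: real assume t: "0 < t" "t < 1"
    have "y + ((1 - t) *\<^sub>R a + t *\<^sub>R b) *\<^sub>R (z - y)
        = (1 - t) *\<^sub>R (y + a *\<^sub>R (z - y)) + t *\<^sub>R (y + b *\<^sub>R (z - y))"
      by (simp add: algebra_simps)
    then show "?h ((1 - t) *\<^sub>R a + t *\<^sub>R b) \<le> (1 - t) * ?h a + t * ?h b"
      using convex_onD[OF convex, of t "y + a *\<^sub>R (z - y)" "y + b *\<^sub>R (z - y)"] t by simp
  qed simp
  from convex_on_imp_above_tangent[OF this, of 0 1 "inner D (z - y)"] D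
  show ?thesis by simp
qed

text \<open>Along the segment from \<open>y\<close> to \<open>x\<close>, subtracting the linear and
  quadratic terms leaves a function whose derivative is nonpositive by Cauchy-Schwarz and the
  Lipschitz bound.\<close>

lemma lipschitz_gradient_quadratic_upper_bound:
  fixes f :: "'a::real_inner \<Rightarrow> real"
  assumes deriv: "\<And>x. GDERIV f x :> g x"
    and lip: "\<And>x y. norm (g x - g y) \<le> L * norm (x - y)"
  shows "f x \<le> f y + inner (g y) (x - y) + L / 2 * (norm (x - y))\<^sup>2"
proof -
  define d where "d = x - y"
  let ?h = "\<lambda>s. f (y + s *\<^sub>R d) - s * inner (g y) d - L / 2 * s\<^sup>2 * (norm d)\<^sup>2"
  have "?h 1 \<le> ?h 0"
  proof (rule DERIV_nonpos_imp_nonincreasing[where f = ?h])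
    fix s :: real assume s: "0 \<le> s" "s \<le> 1"
    have "(?h has_real_derivative
        (inner (g (y + s *\<^sub>R d)) d - inner (g y) d - L * s * (norm d)\<^sup>2)) (at s)"
      by (rule derivative_eq_intros GDERIV_along_line deriv | simp)+
    moreover have "inner (g (y + s *\<^sub>R d) - g y) d \<le> L * s * (norm d)\<^sup>2"
    proof -
      have "inner (g (y + s *\<^sub>R d) - g y) d \<le> norm (g (y + s *\<^sub>R d) - g y) * norm d"
        by (rule norm_cauchy_schwarz)
      also have "\<dots> \<le> (L * norm (s *\<^sub>R d)) * norm d"
        using lip[of "y + s *\<^sub>R d" y] by (intro mult_right_mono) auto
      finally show ?thesis using s by (simp add: power2_eq_square mult.assoc)
    qed
    ultimately show "\<exists>D. (?h has_real_derivative D) (at s) \<and> D \<le> 0"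
      by (intro exI conjI) (auto simp: inner_diff_left)
  qed simp
  then show ?thesis by (simp add: d_def)
qed

text \<open>
  The function \<open>w \<mapsto> f w - \<langle>g y, w\<rangle>\<close> is minimal at \<open>y\<close>; compare its minimum with its value after one
  gradient step of length \<open>1 / L\<close> from \<open>z\<close>.
\<close>

lemma convex_on_lipschitz_gradient_lower_bound:
  fixes f :: "'a::real_inner \<Rightarrow> real"
  assumes "L > 0" and convex: "convex_on UNIV f"
    and deriv: "\<And>x. GDERIV f x :> g x"
    and lip: "\<And>x y. norm (g x - g y) \<le> L * norm (x - y)"
  shows "f z \<ge> f y + inner (g y) (z - y) + (norm (g z - g y))\<^sup>2 / (2 * L)"
proof -
  define w where "w = z - (1 / L) *\<^sub>R (g z - g y)"
  have "f y + inner (g y) (w - y) \<le> f w"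
    by (rule convex_on_GDERIV_above_tangent[OF convex deriv])
  also have "f w \<le> f z + inner (g z) (w - z) + L / 2 * (norm (w - z))\<^sup>2"
    by (rule lipschitz_gradient_quadratic_upper_bound[OF deriv lip])
  finally have "f y + inner (g y) (z - y) \<le> f z + inner (g z - g y) (w - z) + L / 2 * (norm (w - z))\<^sup>2"
    by (simp add: inner_simps)
  also have "inner (g z - g y) (w - z) = - (norm (g z - g y))\<^sup>2 / L"
    by (simp add: w_def power2_norm_eq_inner)
  also have "(norm (w - z))\<^sup>2 = (norm (g z - g y))\<^sup>2 / L\<^sup>2"
    using \<open>L > 0\<close> by (simp add: w_def power_divide)
  finally show ?thesis
    using \<open>L > 0\<close> by (simp add: power2_eq_square field_simps)
qed

text \<open>The lower bound at \<open>z\<close> is subtracted from the upper bound at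
  \<open>x\<close>, both expanded around \<open>w\<close>. Within an epoch, \<open>w\<close> will be
  an inner iterate, \<open>x\<close> the end of the epoch and \<open>z\<close> a comparison point;
  the negative term is kept to absorb gradient deviations.\<close>

lemma convex_on_lipschitz_gradient_three_point:
  fixes f :: "'a::real_inner \<Rightarrow> real"
  assumes "L > 0" "convex_on UNIV f"
    and "\<And>x. GDERIV f x :> g x"
    and "\<And>x y. norm (g x - g y) \<le> L * norm (x - y)"
  shows "f x - f z \<le> inner (g w) (x - z) + L / 2 * (norm (x - w))\<^sup>2 - (norm (g z - g w))\<^sup>2 / (2 * L)"
  using lipschitz_gradient_quadratic_upper_bound[of f g L x w, OF assms(3,4)]
    convex_on_lipschitz_gradient_lower_bound[of L f g w z, OF assms]
  by (simp add: inner_simps)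

section \<open>One epoch\<close>

text \<open>With \<open>a\<close> the gradients at the minimizer this is the shuffling noise of one
  epoch. Tails rather than prefixes occur because an inner iterate differs from the end of the epoch
  by the steps still to come.\<close>

definition tail_energy :: "nat \<Rightarrow> (nat \<Rightarrow> 'a::real_inner) \<Rightarrow> (nat \<Rightarrow> nat) \<Rightarrow> real" where
  "tail_energy n a p = (\<Sum>i=1..n. (norm (\<Sum>j=i..n. a (p j)))\<^sup>2)"

lemma nasg_inner_const_diff:
  assumes "i \<le> n"
  shows "nasg_inner g (\<lambda>_. h) p y i - nasg_inner g (\<lambda>_. h) p y n
    = h *\<^sub>R (\<Sum>j=Suc i..n. g (p j) (nasg_inner g (\<lambda>_. h) p y (j - 1)))"
  using assms
proof (induction n rule: dec_induct)
  case (step m)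
  then show ?case by (simp add: algebra_simps)
qed simp

text \<open>The three-point inequality is summed over the inner steps for the comparison points
  \<open>u\<close> and \<open>z\<close>, and the two results are averaged with weights
  \<open>1 - \<theta>\<close> and \<open>\<theta>\<close>. The quadratic terms involve tail sums of
  the inner gradients, which split into gradients at \<open>z\<close> and deviations from
  them.\<close>

lemma nasg_inner_progress:
  fixes f :: "nat \<Rightarrow> 'a::real_inner \<Rightarrow> real"
  assumes "L > 0" "n \<ge> 1" "\<eta> > 0"
    and convex: "\<And>i. i \<in> {1..n} \<Longrightarrow> convex_on UNIV (f i)"
    and deriv: "\<And>i x. i \<in> {1..n} \<Longrightarrow> GDERIV (f i) x :> g i x"
    and lip: "\<And>i x y. i \<in> {1..n} \<Longrightarrow> norm (g i x - g i y) \<le> L * norm (x - y)"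
    and F: "\<And>w. F w = (\<Sum>i=1..n. f i w) / real n"
    and p: "p permutes {1..n}"
    and X: "X = nasg_inner g (\<lambda>_. \<eta> / real n) p y n"
    and \<theta>: "0 \<le> \<theta>" "\<theta> \<le> 1" "L\<^sup>2 * \<eta>\<^sup>2 \<le> \<theta> / 2"
  shows "F X - (1 - \<theta>) * F u - \<theta> * F z
    \<le> inner (y - X) (X - ((1 - \<theta>) *\<^sub>R u + \<theta> *\<^sub>R z)) / \<eta>
      + L * \<eta>\<^sup>2 / real n ^ 3 * tail_energy n (\<lambda>i. g i z) p"
proof -
  define h where "h = \<eta> / real n"
  \<comment> \<open>The shift by one makes \<open>Y i\<close> the point where step \<open>i\<close>
    evaluates its gradient, so \<open>Y 1 = y\<close>.\<close>
  define Y where "Y i = nasg_inner g (\<lambda>_. h) p y (i - 1)" for i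
  define G where "G i = g (p i) (Y i)" for i
  define D where "D = (\<Sum>i=1..n. (norm (g (p i) z - G i))\<^sup>2)"
  define V where "V = (\<Sum>i=1..n. (norm (X - Y i))\<^sup>2)"
  have n: "real n > 0" using \<open>n \<ge> 1\<close> by simp
  have pin: "p i \<in> {1..n}" if "i \<in> {1..n}" for i
    using permutes_in_image[OF p] that by blast
  have diff: "Y i - X = h *\<^sub>R (\<Sum>j=i..n. G j)" if "i \<in> {1..n}" for i
  proof -
    from that have "i - 1 \<le> n" "Suc (i - 1) = i" by auto
    with nasg_inner_const_diff[of "i - 1" n g h p y] show ?thesis
      by (simp add: Y_def X G_def h_def)
  qed
  have yX: "y - X = h *\<^sub>R (\<Sum>j=1..n. G j)"
    using diff[of 1] \<open>n \<ge> 1\<close> by (simp add: Y_def)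
  have nF: "real n * F w = (\<Sum>i=1..n. f (p i) w)" for w
    using n sum_interval_permutes[OF p, of "\<lambda>i. f i w"] by (simp add: F)
  have three: "real n * (F X - F q) \<le> inner (y - X) (X - q) / h + L / 2 * V
      - (\<Sum>i=1..n. (norm (g (p i) q - G i))\<^sup>2) / (2 * L)" for q
  proof -
    have "real n * (F X - F q) = (\<Sum>i=1..n. f (p i) X - f (p i) q)"
      by (simp add: right_diff_distrib nF sum_subtractf)
    also have "\<dots> \<le> (\<Sum>i=1..n. inner (G i) (X - q) + L / 2 * (norm (X - Y i))\<^sup>2
        - (norm (g (p i) q - G i))\<^sup>2 / (2 * L))"
      unfolding G_def
      by (intro sum_mono convex_on_lipschitz_gradient_three_point \<open>L > 0\<close> convex deriv lip pin)
    also have "\<dots> = inner (\<Sum>i=1..n. G i) (X - q) + L / 2 * V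
      - (\<Sum>i=1..n. (norm (g (p i) q - G i))\<^sup>2) / (2 * L)"
      by (simp add: V_def sum.distrib sum_subtractf inner_sum_left sum_distrib_left sum_divide_distrib)
    also have "inner (\<Sum>i=1..n. G i) (X - q) = inner (y - X) (X - q) / h"
      using \<open>\<eta> > 0\<close> n by (simp add: yX h_def)
    finally show ?thesis .
  qed
  \<comment> \<open>A tail of deviations has at most \<open>n\<close> terms, hence squared norm at
    most \<open>real n * D\<close>; adding \<open>n\<close> such tails scaled by
    \<open>h = \<eta> / n\<close> produces the coefficient \<open>\<eta>\<^sup>2\<close> of
    \<open>D\<close>.\<close>
  have V: "L / 2 * V \<le> L * h\<^sup>2 * tail_energy n (\<lambda>i. g i z) p + L * \<eta>\<^sup>2 * D"
  proof -
    have "(norm (X - Y i))\<^sup>2 \<le> 2 * h\<^sup>2 * (norm (\<Sum>j=i..n. g (p j) z))\<^sup>2 + 2 * h\<^sup>2 * real n * D"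
      if i: "i \<in> {1..n}" for i
    proof -
      have "(\<Sum>j=i..n. G j) = (\<Sum>j=i..n. g (p j) z) + (\<Sum>j=i..n. G j - g (p j) z)"
        by (simp add: sum_subtractf)
      then have "(norm (\<Sum>j=i..n. G j))\<^sup>2
          \<le> 2 * (norm (\<Sum>j=i..n. g (p j) z))\<^sup>2 + 2 * (norm (\<Sum>j=i..n. G j - g (p j) z))\<^sup>2"
        using norm_add_squared_le by metis
      moreover have "(norm (\<Sum>j=i..n. G j - g (p j) z))\<^sup>2 \<le> real n * D"
      proof -
        have "(norm (\<Sum>j=i..n. G j - g (p j) z))\<^sup>2
            \<le> real (card {i..n}) * (\<Sum>j=i..n. (norm (G j - g (p j) z))\<^sup>2)"
          by (rule norm_sum_squared_le)
        also have "\<dots> \<le> real n * D"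
          using i unfolding D_def
          by (intro mult_mono) (auto simp: norm_minus_commute intro!: sum_mono2 sum_nonneg)
        finally show ?thesis .
      qed
      ultimately have "(norm (\<Sum>j=i..n. G j))\<^sup>2
          \<le> 2 * (norm (\<Sum>j=i..n. g (p j) z))\<^sup>2 + 2 * (real n * D)" by linarith
      from mult_left_mono[OF this, of "h\<^sup>2"]
      have "h\<^sup>2 * (norm (\<Sum>j=i..n. G j))\<^sup>2
          \<le> 2 * h\<^sup>2 * (norm (\<Sum>j=i..n. g (p j) z))\<^sup>2 + 2 * h\<^sup>2 * real n * D"
        by (simp add: algebra_simps)
      moreover have "(norm (X - Y i))\<^sup>2 = h\<^sup>2 * (norm (\<Sum>j=i..n. G j))\<^sup>2"
        by (metis diff[OF i] norm_minus_commute norm_scaleR power_mult_distrib power2_abs)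
      ultimately show ?thesis by simp
    qed
    then have "V \<le> (\<Sum>i=1..n. 2 * h\<^sup>2 * (norm (\<Sum>j=i..n. g (p j) z))\<^sup>2 + 2 * h\<^sup>2 * real n * D)"
      unfolding V_def by (intro sum_mono)
    also have "\<dots> = 2 * h\<^sup>2 * tail_energy n (\<lambda>i. g i z) p + 2 * (h * real n)\<^sup>2 * D"
      by (simp add: tail_energy_def sum.distrib sum_distrib_left power2_eq_square algebra_simps)
    also have "h * real n = \<eta>" using n by (simp add: h_def)
    finally have "L / 2 * V \<le> L / 2 * (2 * h\<^sup>2 * tail_energy n (\<lambda>i. g i z) p + 2 * \<eta>\<^sup>2 * D)"
      using \<open>L > 0\<close> by (intro mult_left_mono) auto
    then show ?thesis by (simp add: algebra_simps)
  qed
  have D0: "D \<ge> 0" unfolding D_def by (intro sum_nonneg) auto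
  \<comment> \<open>The bound on \<open>L\<^sup>2 * \<eta>\<^sup>2\<close> is exactly what lets the
    cocoercivity term at \<open>z\<close>, weighted by \<open>\<theta>\<close>, cancel the
    deviations.\<close>
  have LD: "L * \<eta>\<^sup>2 * D \<le> \<theta> * (D / (2 * L))"
  proof -
    have "L\<^sup>2 * \<eta>\<^sup>2 * (D / L) \<le> \<theta> / 2 * (D / L)"
      using \<theta> D0 \<open>L > 0\<close> by (intro mult_right_mono) auto
    then show ?thesis using \<open>L > 0\<close> by (simp add: power2_eq_square field_simps)
  qed
  have "real n * (F X - F u) \<le> inner (y - X) (X - u) / h + L / 2 * V"
    using three[of u] \<open>L > 0\<close> by (smt (verit) divide_nonneg_pos sum_nonneg zero_le_power2)
  then have "(1 - \<theta>) * (real n * (F X - F u)) \<le> (1 - \<theta>) * (inner (y - X) (X - u) / h + L / 2 * V)"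
    using \<theta> by (intro mult_left_mono) auto
  moreover have "\<theta> * (real n * (F X - F z))
      \<le> \<theta> * (inner (y - X) (X - z) / h + L / 2 * V - D / (2 * L))"
    using \<theta> three[of z] by (intro mult_left_mono) (auto simp: D_def)
  ultimately have "real n * (F X - (1 - \<theta>) * F u - \<theta> * F z)
      \<le> ((1 - \<theta>) * inner (y - X) (X - u) + \<theta> * inner (y - X) (X - z)) / h
        + L / 2 * V - \<theta> * (D / (2 * L))"
    by (simp add: algebra_simps add_divide_distrib diff_divide_distrib)
  also have "(1 - \<theta>) * inner (y - X) (X - u) + \<theta> * inner (y - X) (X - z)
      = inner (y - X) (X - ((1 - \<theta>) *\<^sub>R u + \<theta> *\<^sub>R z))"
    by (simp add: inner_simps algebra_simps)
  finally have "real n * (F X - (1 - \<theta>) * F u - \<theta> * F z)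
      \<le> inner (y - X) (X - ((1 - \<theta>) *\<^sub>R u + \<theta> *\<^sub>R z)) / h
        + L * h\<^sup>2 * tail_energy n (\<lambda>i. g i z) p"
    using V LD by linarith
  then have "F X - (1 - \<theta>) * F u - \<theta> * F z
      \<le> (inner (y - X) (X - ((1 - \<theta>) *\<^sub>R u + \<theta> *\<^sub>R z)) / h
        + L * h\<^sup>2 * tail_energy n (\<lambda>i. g i z) p) / real n"
    using n by (simp add: pos_le_divide_eq mult.commute)
  also have "\<dots> = inner (y - X) (X - ((1 - \<theta>) *\<^sub>R u + \<theta> *\<^sub>R z)) / \<eta>
      + L * \<eta>\<^sup>2 / real n ^ 3 * tail_energy n (\<lambda>i. g i z) p"
    using n by (simp add: h_def add_divide_distrib power2_eq_square power3_eq_cube)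
  finally show ?thesis .
qed

section \<open>The potential along the epochs\<close>

text \<open>Here \<open>m\<close> counts the completed epochs and \<open>2 / (m + 2)\<close> is the
  weight of the next one. Multiplication by \<open>(m + 2)\<^sup>2\<close> turns the factors of the
  inner product into \<open>2 (v - v')\<close> and \<open>2 v'\<close>, and polarization yields a
  difference of squared distances to \<open>z\<close>.\<close>

lemma nasg_potential_step:
  fixes u y X z :: "'a::real_inner" and m :: real
  assumes "m \<ge> 0" "\<eta> > 0"
    and progress: "FX - (1 - 2 / (m + 2)) * Fu - 2 / (m + 2) * Fz
      \<le> inner (y - X) (X - ((1 - 2 / (m + 2)) *\<^sub>R u + (2 / (m + 2)) *\<^sub>R z)) / \<eta> + e"
  shows "(m + 2)\<^sup>2 * (FX - Fz) + 2 / \<eta> * (norm (X + (m / 2) *\<^sub>R (X - u) - z))\<^sup>2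
    \<le> m * (m + 2) * (Fu - Fz) + 2 / \<eta> * (norm (u + ((m + 2) / 2) *\<^sub>R (y - u) - z))\<^sup>2
      + (m + 2)\<^sup>2 * e"
proof -
  define v where "v = u + ((m + 2) / 2) *\<^sub>R (y - u) - z"
  define v' where "v' = X + (m / 2) *\<^sub>R (X - u) - z"
  have m: "m + 2 > 0" using assms by simp
  have 1: "(m + 2) *\<^sub>R (y - X) = 2 *\<^sub>R (v - v')"
  proof -
    have "2 *\<^sub>R (v - v') = 2 *\<^sub>R u + (m + 2) *\<^sub>R (y - u) - 2 *\<^sub>R X - m *\<^sub>R (X - u)"
    proof -
      have half: "2 * (b / 2) = b" for b :: real by simp
      show ?thesis
        unfolding v_def v'_def scaleR_diff_right scaleR_add_right scaleR_scaleR half by simp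
    qed
    then show ?thesis by (simp add: algebra_simps)
  qed
  have c: "(m + 2) * (1 - 2 / (m + 2)) = m" and c': "(m + 2) * (2 / (m + 2)) = 2"
    using m by (simp_all add: field_simps)
  have 2: "(m + 2) *\<^sub>R (X - ((1 - 2 / (m + 2)) *\<^sub>R u + (2 / (m + 2)) *\<^sub>R z)) = 2 *\<^sub>R v'"
    unfolding scaleR_diff_right scaleR_add_right scaleR_scaleR c c' v'_def
    by (simp add: algebra_simps)
  have "(m + 2)\<^sup>2 * inner (y - X) (X - ((1 - 2 / (m + 2)) *\<^sub>R u + (2 / (m + 2)) *\<^sub>R z))
      = inner ((m + 2) *\<^sub>R (y - X)) ((m + 2) *\<^sub>R (X - ((1 - 2 / (m + 2)) *\<^sub>R u + (2 / (m + 2)) *\<^sub>R z)))"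
    by (simp only: inner_scaleR_left inner_scaleR_right power2_eq_square mult.assoc)
  also have "\<dots> = 4 * inner (v - v') v'" unfolding 1 2 by simp
  also have "\<dots> = 2 * (norm v)\<^sup>2 - 2 * (norm v')\<^sup>2 - 2 * (norm (v - v'))\<^sup>2"
    by (simp add: power2_norm_eq_inner inner_simps inner_commute)
  also have "\<dots> \<le> 2 * (norm v)\<^sup>2 - 2 * (norm v')\<^sup>2" by simp
  finally have 3: "(m + 2)\<^sup>2 * inner (y - X) (X - ((1 - 2 / (m + 2)) *\<^sub>R u + (2 / (m + 2)) *\<^sub>R z)) / \<eta>
      \<le> (2 * (norm v)\<^sup>2 - 2 * (norm v')\<^sup>2) / \<eta>"
    using \<open>\<eta> > 0\<close> by (simp add: divide_right_mono)
  have "(m + 2)\<^sup>2 * (FX - (1 - 2 / (m + 2)) * Fu - 2 / (m + 2) * Fz)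
      = (m + 2)\<^sup>2 * (FX - Fz) - m * (m + 2) * (Fu - Fz)"
  proof -
    have "b\<^sup>2 * (FX - p * Fu - q * Fz) = b * (b * FX - (b * p) * Fu - (b * q) * Fz)" for b p q
      by (simp add: power2_eq_square algebra_simps)
    from this[of "m + 2" "1 - 2 / (m + 2)" "2 / (m + 2)"] show ?thesis
      unfolding c c' by (simp add: algebra_simps power2_eq_square)
  qed
  moreover have "(m + 2)\<^sup>2 * (FX - (1 - 2 / (m + 2)) * Fu - 2 / (m + 2) * Fz)
      \<le> (m + 2)\<^sup>2 * (inner (y - X) (X - ((1 - 2 / (m + 2)) *\<^sub>R u + (2 / (m + 2)) *\<^sub>R z)) / \<eta> + e)"
    using progress by (intro mult_left_mono) auto
  ultimately show ?thesis
    using 3 unfolding v_def v'_def by (simp add: algebra_simps diff_divide_distrib)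
qed

lemma nasg_pathwise_bound:
  fixes f :: "nat \<Rightarrow> 'a::real_inner \<Rightarrow> real"
  assumes "L > 0" "n \<ge> 1"
    and convex: "\<And>i. i \<in> {1..n} \<Longrightarrow> convex_on UNIV (f i)"
    and deriv: "\<And>i x. i \<in> {1..n} \<Longrightarrow> GDERIV (f i) x :> g i x"
    and lip: "\<And>i x y. i \<in> {1..n} \<Longrightarrow> norm (g i x - g i y) \<le> L * norm (x - y)"
    and F: "\<And>w. F w = (\<Sum>i=1..n. f i w) / real n"
    and min: "\<And>w. F z \<le> F w"
    and \<gamma>: "\<And>t. \<gamma> t = (real t - 1) / (real t + 2)"
    and \<eta>: "\<And>t. \<eta> t > 0" "mono \<eta>"
    and small: "\<And>t. t \<in> {1..T} \<Longrightarrow> L\<^sup>2 * (\<eta> t)\<^sup>2 \<le> 1 / (real t + 1)"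
    and perm: "\<And>t. t \<in> {1..T} \<Longrightarrow> \<pi> t permutes {1..n}"
  shows "real T * (real T + 2) * (F (nasg n g \<gamma> (\<lambda>t i. \<eta> t / real n) \<pi> x0 x0 T) - F z)
    \<le> 2 / \<eta> 1 * (norm (x0 - z))\<^sup>2
      + (\<Sum>t=1..T. (real t + 1)\<^sup>2 * (L * (\<eta> t)\<^sup>2 / real n ^ 3 * tail_energy n (\<lambda>i. g i z) (\<pi> t)))"
proof -
  define S where "S = nasg_state n g \<gamma> (\<lambda>t i. \<eta> t / real n) \<pi> x0 x0"
  define x where "x t = fst (S t)" for t
  define y where "y t = snd (S t)" for t
  define v where "v t = x t + ((real t + 2) / 2) *\<^sub>R (y t - x t)" for t
  define e where "e t = L * (\<eta> t)\<^sup>2 / real n ^ 3 * tail_energy n (\<lambda>i. g i z) (\<pi> t)" for t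
  \<comment> \<open>The distance carries the step size of the epoch about to start, as
    \<open>nasg_potential_step\<close> expects; at \<open>t = T\<close> this is one step size beyond
    the last epoch.\<close>
  have potential: "real t * (real t + 2) * (F (x t) - F z) + 2 / \<eta> (Suc t) * (norm (v t - z))\<^sup>2
      \<le> 2 / \<eta> 1 * (norm (x0 - z))\<^sup>2 + (\<Sum>s=1..t. (real s + 1)\<^sup>2 * e s)" if "t \<le> T" for t
    using that
  proof (induction t)
    case 0
    \<comment> \<open>The function gap has coefficient 0 here, and \<open>v 0 = x0\<close> because
      both initial points coincide.\<close>
    show ?case by (simp add: v_def x_def y_def S_def)
  next
    case (Suc t)
    define m where "m = real t"
    have t: "Suc t \<in> {1..T}" using Suc.prems by simp
    have x': "x (Suc t) = nasg_inner g (\<lambda>_. \<eta> (Suc t) / real n) (\<pi> (Suc t)) (y t) n"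
      and y': "y (Suc t) = x (Suc t) + \<gamma> (Suc t) *\<^sub>R (x (Suc t) - x t)"
      by (simp_all add: x_def y_def S_def Let_def split: prod.splits)
    have v': "v (Suc t) = x (Suc t) + (m / 2) *\<^sub>R (x (Suc t) - x t)"
    proof -
      \<comment> \<open>The momentum \<open>\<gamma> (Suc t)\<close> equals
        \<open>m / (m + 3)\<close>, and the factor in front of it is
        \<open>(m + 3) / 2\<close>.\<close>
      have "(real (Suc t) + 2) / 2 * \<gamma> (Suc t) = m / 2"
        by (simp add: \<gamma> m_def divide_simps)
      then show ?thesis by (simp add: v_def y' del: of_nat_Suc)
    qed
    have "F (x (Suc t)) - (1 - 2 / (m + 2)) * F (x t) - 2 / (m + 2) * F z
      \<le> inner (y t - x (Suc t)) (x (Suc t) - ((1 - 2 / (m + 2)) *\<^sub>R x t + (2 / (m + 2)) *\<^sub>R z)) / \<eta> (Suc t)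
        + e (Suc t)"
      unfolding e_def
      by (rule nasg_inner_progress[where L = L and f = f])
        (use assms(1-6) \<eta> perm[OF t] small[OF t] x' in \<open>auto simp: m_def field_simps\<close>)
    from nasg_potential_step[OF _ _ this]
    have "(m + 2)\<^sup>2 * (F (x (Suc t)) - F z) + 2 / \<eta> (Suc t) * (norm (v (Suc t) - z))\<^sup>2
        \<le> m * (m + 2) * (F (x t) - F z) + 2 / \<eta> (Suc t) * (norm (v t - z))\<^sup>2 + (m + 2)\<^sup>2 * e (Suc t)"
      unfolding v' unfolding v_def using \<eta> by (simp add: m_def)
    also have "\<dots> \<le> 2 / \<eta> 1 * (norm (x0 - z))\<^sup>2 + (\<Sum>s=1..t. (real s + 1)\<^sup>2 * e s)
        + (m + 2)\<^sup>2 * e (Suc t)"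
      using Suc by (simp add: m_def)
    also have "\<dots> = 2 / \<eta> 1 * (norm (x0 - z))\<^sup>2 + (\<Sum>s=1..Suc t. (real s + 1)\<^sup>2 * e s)"
      by (simp add: m_def add_ac)
    finally have *: "(m + 2)\<^sup>2 * (F (x (Suc t)) - F z) + 2 / \<eta> (Suc t) * (norm (v (Suc t) - z))\<^sup>2
      \<le> 2 / \<eta> 1 * (norm (x0 - z))\<^sup>2 + (\<Sum>s=1..Suc t. (real s + 1)\<^sup>2 * e s)" .
    \<comment> \<open>The left coefficient is \<open>(m + 2)\<^sup>2 - 1\<close>, and the gap is
      nonnegative since \<open>z\<close> is a minimizer.\<close>
    have "real (Suc t) * (real (Suc t) + 2) * (F (x (Suc t)) - F z) \<le> (m + 2)\<^sup>2 * (F (x (Suc t)) - F z)"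
      using min by (intro mult_right_mono) (auto simp: m_def power2_eq_square algebra_simps)
    moreover have "2 / \<eta> (Suc (Suc t)) * (norm (v (Suc t) - z))\<^sup>2 \<le> 2 / \<eta> (Suc t) * (norm (v (Suc t) - z))\<^sup>2"
      using \<eta> by (intro mult_right_mono divide_left_mono mult_pos_pos) (auto simp: mono_def)
    ultimately show ?case using * by linarith
  qed
  have "0 \<le> 2 / \<eta> (Suc T) * (norm (v T - z))\<^sup>2" using \<eta>(1)[of "Suc T"] by simp
  with potential[of T] show ?thesis
    by (simp add: nasg_def x_def S_def e_def)
qed

section \<open>Sampling without replacement\<close>

text \<open>Right composition with \<open>q\<close> is a bijection of the finite set of
  permutations. This expresses the exchangeability of the positions in a random order.\<close>

lemma uniform_permutation_compose:
  assumes "q permutes {1..n}"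
  shows "map_pmf (\<lambda>p. p \<circ> q) (uniform_permutation n) = uniform_permutation n"
proof -
  have "(\<lambda>p. p \<circ> q) ` {p. p permutes {1..n}} = {p. p permutes {1..n}}"
    using image_compose_permutations_right[OF assms] by (simp add: setcompr_eq_image)
  moreover have "inj_on (\<lambda>p. p \<circ> q) {p. p permutes {1..n}}"
    by (intro inj_onI) (metis assms fun.inj_map_strong permutes_surj surj_fun_eq)
  moreover have "{p. p permutes {1..n}} \<noteq> {}"
    using permutes_id by blast
  ultimately show ?thesis
    unfolding uniform_permutation_def
    by (subst map_pmf_of_set_inj) (simp_all add: finite_permutations)
qed

lemma set_uniform_permutation: "set_pmf (uniform_permutation n) = {p. p permutes {1..n}}"
proof -
  have "{p. p permutes {1..n}} \<noteq> {}"
    using permutes_id by blast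
  then show ?thesis
    unfolding uniform_permutation_def by (intro set_pmf_of_set) (simp_all add: finite_permutations)
qed

lemma integrable_uniform_permutation [simp]:
  fixes h :: "(nat \<Rightarrow> nat) \<Rightarrow> real"
  shows "integrable (measure_pmf (uniform_permutation n)) h"
  by (intro integrable_measure_pmf_finite) (simp add: set_uniform_permutation finite_permutations)

text \<open>
  Cross terms have nonpositive mean: for fixed \<open>j\<close> all \<open>\<E>\<langle>a (p j), a (p l)\<rangle>\<close> with \<open>l \<noteq> j\<close> agree by
  symmetry, and together with \<open>\<E>\<parallel>a (p j)\<parallel>\<^sup>2\<close> they add up to \<open>0\<close>.
\<close>

lemma expectation_uniform_permutation_norm_sum:
  fixes a :: "nat \<Rightarrow> 'a::real_inner"
  assumes zero: "(\<Sum>i=1..n. a i) = 0" and A: "A \<subseteq> {1..n}"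
  shows "measure_pmf.expectation (uniform_permutation n) (\<lambda>p. (norm (\<Sum>j\<in>A. a (p j)))\<^sup>2)
    \<le> real (card A) * ((\<Sum>i=1..n. (norm (a i))\<^sup>2) / real n)"
proof -
  let ?E = "measure_pmf.expectation (uniform_permutation n)"
  define s where "s j l = ?E (\<lambda>p. inner (a (p j)) (a (p l)))" for j l
  have sym: "s (q j) (q l) = s j l" if q: "q permutes {1..n}" for q j l
  proof -
    have "s j l = measure_pmf.expectation (map_pmf (\<lambda>p. p \<circ> q) (uniform_permutation n))
        (\<lambda>p. inner (a (p j)) (a (p l)))"
      by (simp only: s_def uniform_permutation_compose[OF q])
    then show ?thesis by (simp add: s_def)
  qed
  have row: "(\<Sum>l=1..n. s j l) = 0" for j
  proof -
    have "(\<Sum>l=1..n. s j l) = ?E (\<lambda>p. \<Sum>l=1..n. inner (a (p j)) (a (p l)))"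
      unfolding s_def by (rule Bochner_Integration.integral_sum[symmetric]) simp
    also have "\<dots> = ?E (\<lambda>p. 0)"
    proof (intro integral_cong_AE AE_pmfI)
      fix p assume "p \<in> set_pmf (uniform_permutation n)"
      then have "p permutes {1..n}" by (simp add: set_uniform_permutation)
      then show "(\<Sum>l=1..n. inner (a (p j)) (a (p l))) = 0"
        using sum_interval_permutes[of p n a] zero by (simp flip: inner_sum_right)
    qed auto
    finally show ?thesis by simp
  qed
  have diag_eq: "s j j = s l l" if "j \<in> {1..n}" "l \<in> {1..n}" for j l
    using sym[OF permutes_swap_id[OF that], of j j] by simp
  have diag: "real n * s j j = (\<Sum>i=1..n. (norm (a i))\<^sup>2)" if j: "j \<in> {1..n}" for j
  proof -
    have "real n * s j j = (\<Sum>l=1..n. s l l)"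
      using sum.cong[OF refl diag_eq[OF j], of "{1..n}"] by simp
    also have "\<dots> = ?E (\<lambda>p. \<Sum>l=1..n. inner (a (p l)) (a (p l)))"
      unfolding s_def by (rule Bochner_Integration.integral_sum[symmetric]) simp
    also have "\<dots> = ?E (\<lambda>p. \<Sum>i=1..n. (norm (a i))\<^sup>2)"
    proof (intro integral_cong_AE AE_pmfI)
      fix p assume "p \<in> set_pmf (uniform_permutation n)"
      then have "p permutes {1..n}" by (simp add: set_uniform_permutation)
      then show "(\<Sum>l=1..n. inner (a (p l)) (a (p l))) = (\<Sum>i=1..n. (norm (a i))\<^sup>2)"
        using sum_interval_permutes[of p n "\<lambda>i. inner (a i) (a i)"] by (simp add: power2_norm_eq_inner)
    qed auto
    finally show ?thesis by simp
  qed
  have cross: "s j l \<le> 0" if jl: "j \<in> {1..n}" "l \<in> {1..n}" "j \<noteq> l" for j l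
  proof -
    \<comment> \<open>The transposition of \<open>l\<close> and \<open>i\<close> fixes
      \<open>j\<close>, which is why \<open>sym\<close> changes only the second index.\<close>
    have "s j i = s j l" if "i \<in> {1..n} - {j}" for i
      using sym[OF permutes_swap_id[of l "{1..n}" i], of j l] that jl by simp
    then have "(\<Sum>i\<in>{1..n} - {j}. s j i) = real (card ({1..n} - {j})) * s j l" by simp
    moreover have "(\<Sum>i=1..n. s j i) = s j j + (\<Sum>i\<in>{1..n} - {j}. s j i)"
      using jl by (intro sum.remove) auto
    moreover have "s j j \<ge> 0" unfolding s_def by (intro integral_nonneg_AE) auto
    moreover have "card ({1..n} - {j}) > 0"
      using jl by (subst card_gt_0_iff) auto
    ultimately show ?thesis
      using row[of j] by (smt (verit) mult_pos_pos of_nat_0_less_iff)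
  qed
  have "?E (\<lambda>p. (norm (\<Sum>j\<in>A. a (p j)))\<^sup>2) = ?E (\<lambda>p. \<Sum>j\<in>A. \<Sum>l\<in>A. inner (a (p j)) (a (p l)))"
    by (simp add: power2_norm_eq_inner inner_sum_left inner_sum_right inner_commute)
  also have "\<dots> = (\<Sum>j\<in>A. \<Sum>l\<in>A. s j l)"
    unfolding s_def by (simp add: Bochner_Integration.integral_sum)
  also have "\<dots> \<le> (\<Sum>j\<in>A. s j j)"
  proof (intro sum_mono)
    fix j assume j: "j \<in> A"
    have "(\<Sum>l\<in>A. s j l) = s j j + (\<Sum>l\<in>A - {j}. s j l)"
      using j A by (intro sum.remove) (auto intro: finite_subset)
    moreover have "(\<Sum>l\<in>A - {j}. s j l) \<le> 0"
      using cross j A by (intro sum_nonpos) blast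
    ultimately show "(\<Sum>l\<in>A. s j l) \<le> s j j" by linarith
  qed
  also have "\<dots> = (\<Sum>j\<in>A. (\<Sum>i=1..n. (norm (a i))\<^sup>2) / real n)"
  proof (intro sum.cong refl)
    fix j assume "j \<in> A"
    then have "j \<in> {1..n}" using A by blast
    with diag[OF this] show "s j j = (\<Sum>i=1..n. (norm (a i))\<^sup>2) / real n"
      by (simp add: eq_divide_eq mult.commute)
  qed
  finally show ?thesis by simp
qed

text \<open>Each tail has at most \<open>n\<close> indices, so its mean squared norm is at most the
  full sum of squared norms; there are \<open>n\<close> tails.\<close>

lemma expectation_tail_energy_le:
  fixes a :: "nat \<Rightarrow> 'a::real_inner"
  assumes "(\<Sum>i=1..n. a i) = 0"
  shows "measure_pmf.expectation (uniform_permutation n) (tail_energy n a)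
    \<le> real n * (\<Sum>i=1..n. (norm (a i))\<^sup>2)"
proof -
  have "measure_pmf.expectation (uniform_permutation n) (tail_energy n a)
      = (\<Sum>i=1..n. measure_pmf.expectation (uniform_permutation n) (\<lambda>p. (norm (\<Sum>j=i..n. a (p j)))\<^sup>2))"
    unfolding tail_energy_def by (simp add: Bochner_Integration.integral_sum)
  also have "\<dots> \<le> (\<Sum>i=1..n. real n * ((\<Sum>i=1..n. (norm (a i))\<^sup>2) / real n))"
  proof (intro sum_mono)
    fix i assume i: "i \<in> {1..n}"
    have "measure_pmf.expectation (uniform_permutation n) (\<lambda>p. (norm (\<Sum>j=i..n. a (p j)))\<^sup>2)
        \<le> real (card {i..n}) * ((\<Sum>i=1..n. (norm (a i))\<^sup>2) / real n)"
      using i by (intro expectation_uniform_permutation_norm_sum assms) auto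
    also have "\<dots> \<le> real n * ((\<Sum>i=1..n. (norm (a i))\<^sup>2) / real n)"
      using i by (intro mult_right_mono divide_nonneg_nonneg sum_nonneg) auto
    finally show "measure_pmf.expectation (uniform_permutation n) (\<lambda>p. (norm (\<Sum>j=i..n. a (p j)))\<^sup>2)
        \<le> real n * ((\<Sum>i=1..n. (norm (a i))\<^sup>2) / real n)" .
  qed
  also have "\<dots> = real n * (\<Sum>i=1..n. (norm (a i))\<^sup>2)" by simp
  finally show ?thesis .
qed

text \<open>Both schemes enter the convergence proof through these two facts: finite support makes
  every function integrable, and the law of a single epoch's permutation determines the mean of its
  noise.\<close>

lemma shuffling_schemes:
  assumes "\<P> = random_reshuffling n T \<or> \<P> = single_shuffling n"
  shows "finite (set_pmf \<P>)"
    and "t \<in> {1..T} \<Longrightarrow> map_pmf (\<lambda>\<pi>. \<pi> t) \<P> = uniform_permutation n"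
proof -
  have fin: "finite (set_pmf (uniform_permutation n))"
    by (simp add: set_uniform_permutation finite_permutations)
  show "finite (set_pmf \<P>)"
    using assms fin
    by (auto simp: random_reshuffling_def single_shuffling_def set_Pi_pmf intro!: finite_PiE_dflt)
  show "map_pmf (\<lambda>\<pi>. \<pi> t) \<P> = uniform_permutation n" if "t \<in> {1..T}"
    using assms that
    by (auto simp: random_reshuffling_def single_shuffling_def Pi_pmf_component pmf.map_comp o_def)
qed

section \<open>The convergence rate\<close>

text \<open>The derivative at a minimizer vanishes in every direction; in the direction of the
  gradient sum itself it equals the squared norm of that sum.\<close>

lemma sum_gradients_at_minimum:
  fixes f :: "nat \<Rightarrow> 'a::real_inner \<Rightarrow> real"
  assumes "n \<ge> 1" and deriv: "\<And>i. i \<in> {1..n} \<Longrightarrow> GDERIV (f i) z :> g i"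
    and F: "\<And>w. F w = (\<Sum>i=1..n. f i w) / real n" and min: "\<And>w. F z \<le> F w"
  shows "(\<Sum>i=1..n. g i) = 0"
proof -
  let ?G = "\<Sum>i=1..n. g i"
  have "((\<lambda>w. \<Sum>i=1..n. f i w) has_derivative (\<lambda>h. \<Sum>i=1..n. inner h (g i))) (at z)"
    using deriv by (intro has_derivative_sum) (auto simp: gderiv_def)
  then have "((\<lambda>w. \<Sum>i=1..n. f i w) has_derivative (\<lambda>h. inner h ?G)) (at z)"
    by (simp add: inner_sum_right)
  moreover have "(\<Sum>i=1..n. f i z) \<le> (\<Sum>i=1..n. f i w)" for w
    using min[of w] \<open>n \<ge> 1\<close> by (simp add: F divide_le_cancel)
  ultimately have "(\<lambda>h. inner h ?G) = (\<lambda>h. 0)"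
    using differential_zero_maxmin[of z UNIV "\<lambda>w. \<Sum>i=1..n. f i w" "\<lambda>h. inner h ?G"] by auto
  from fun_cong[OF this, of ?G] show ?thesis by simp
qed

theorem corollaryE3:
  fixes f :: "nat \<Rightarrow> 'a::euclidean_space \<Rightarrow> real"
    and grad :: "nat \<Rightarrow> 'a \<Rightarrow> 'a"
    and F :: "'a \<Rightarrow> real"
    and L E \<sigma>star \<alpha> k :: real
    and n T :: nat
    and x0 xstar :: 'a
    and \<gamma> \<eta> :: "nat \<Rightarrow> real"
    and \<P> :: "(nat \<Rightarrow> nat \<Rightarrow> nat) pmf"
  assumes "L > 0" and "n \<ge> 1"
    and "\<And>i. i \<in> {1..n} \<Longrightarrow> convex_on UNIV (f i)"
    and "\<And>i x. i \<in> {1..n} \<Longrightarrow> GDERIV (f i) x :> grad i x"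
    and "\<And>i x y. i \<in> {1..n} \<Longrightarrow> norm (grad i x - grad i y) \<le> L * norm (x - y)"
    and "\<And>w. F w = (\<Sum>i=1..n. f i w) / real n"
    and "E > 0"
    and "\<And>w. F xstar \<le> F w"
    and "norm (x0 - xstar) \<le> E / sqrt (real n)"
    and "\<sigma>star\<^sup>2 = (\<Sum>i=1..n. (norm (grad i xstar))\<^sup>2) / real n"
    and "T \<ge> 2"
    and "\<alpha> = 1 + 1 / real T"
    and "k = 1 / (exp 1 * \<alpha> * root 3 12)"
    and "\<And>t. \<gamma> t = (real t - 1) / (real t + 2)"
    and "\<And>t. \<eta> t = k * \<alpha> ^ t / (L * real T)"
    and "\<And>t. t \<in> {1..T} \<Longrightarrow> \<eta> t / real n > 0"
    and "\<And>t. t \<in> {1..T} \<Longrightarrow> \<eta> t \<le> 1 / L"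
    and "\<P> = random_reshuffling n T \<or> \<P> = single_shuffling n"
  shows "measure_pmf.expectation \<P>
           (\<lambda>\<pi>. F (nasg n grad \<gamma> (\<lambda>t i. \<eta> t / real n) \<pi> x0 x0 T) - F xstar)
         \<le> 8 * \<sigma>star\<^sup>2 / (27 * real n * L * real T)
           + 2 * L * E\<^sup>2 * exp 1 * root 3 12 / (real n * real T)"
proof -
  define r where "r = root 3 (12::real)"
  define N where "N = real n"
  define \<tau> where "\<tau> = real T"
  let ?a = "\<lambda>i. grad i xstar"
  let ?x = "\<lambda>\<pi>. nasg n grad \<gamma> (\<lambda>t i. \<eta> t / real n) \<pi> x0 x0 T"
  have \<tau>: "\<tau> \<ge> 2" and N: "N > 0" and \<alpha>: "\<alpha> > 1"
    using assms(2,11,12) by (auto simp: \<tau>_def N_def)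

  \<comment> \<open>Step size estimates\<close>
  have r: "r \<ge> 2"
  proof -
    have "root 3 (2 ^ 3) = (2 :: real)" by (rule real_root_power_cancel) auto
    moreover have "root 3 (2 ^ 3) \<le> r" unfolding r_def by (rule real_root_le_mono) auto
    ultimately show ?thesis by simp
  qed
  \<comment> \<open>The factor \<alpha> in the denominator of \<open>k\<close> lowers the exponent
    by one, so the first step size is free of \<alpha>.\<close>
  have \<eta>_eq: "\<eta> (Suc t) = \<alpha> ^ t / (exp 1 * r * L * \<tau>)" for t
    using \<alpha> by (simp add: assms(13,15) r_def \<tau>_def)
  have k: "k > 0" using \<alpha> r by (simp add: assms(13) r_def)
  have \<eta>_pos: "\<eta> t > 0" for t
    using k \<alpha> \<open>L > 0\<close> \<tau> by (simp add: assms(15) \<tau>_def)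
  have \<eta>_mono: "mono \<eta>"
    using k \<alpha> \<open>L > 0\<close> \<tau>
    by (intro monoI) (simp add: assms(15) \<tau>_def divide_right_mono mult_left_mono power_increasing)
  \<comment> \<open>The bound \<open>(1 + 1 / T) ^ T \<le> exp 1\<close> is cancelled by the factor
    \<open>exp 1\<close> in \<open>k\<close>; the 2 comes from \<open>r \<ge> 2\<close>, that is,
    from \<open>12 \<ge> 8\<close>.\<close>
  have \<eta>_le: "L * \<eta> t \<le> 1 / (2 * \<tau>)" if t: "t \<in> {1..T}" for t
  proof -
    have "\<alpha> ^ (t - 1) \<le> \<alpha> ^ T" using t \<alpha> by (intro power_increasing) auto
    also have "\<dots> \<le> exp 1"
      using exp_ge_one_plus_x_over_n_power_n[of T 1] \<open>T \<ge> 2\<close> by (simp add: assms(12))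
    finally have "\<alpha> ^ (t - 1) * 2 \<le> exp 1 * r"
      using r by (intro mult_mono) auto
    then have "\<alpha> ^ (t - 1) / (exp 1 * r) \<le> 1 / 2"
      using r by (simp add: divide_simps)
    then have "\<alpha> ^ (t - 1) / (exp 1 * r) / \<tau> \<le> 1 / 2 / \<tau>"
      using \<tau> by (intro divide_right_mono) auto
    moreover have "L * \<eta> t = \<alpha> ^ (t - 1) / (exp 1 * r) / \<tau>"
      using \<eta>_eq[of "t - 1"] t \<open>L > 0\<close> by simp
    ultimately show ?thesis by simp
  qed
  have \<eta>_sq: "L\<^sup>2 * (\<eta> t)\<^sup>2 \<le> 1 / (4 * \<tau>\<^sup>2)" if t: "t \<in> {1..T}" for t
    using power_mono[OF \<eta>_le[OF t], of 2] \<open>L > 0\<close> less_imp_le[OF \<eta>_pos[of t]]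
    by (simp add: power_mult_distrib power_divide)
  \<comment> \<open>The right-hand side is half of \<open>2 / (real t + 1)\<close>, the weight of
    epoch \<open>t\<close>, so this is the step-size condition of
    \<open>nasg_inner_progress\<close>.\<close>
  have small: "L\<^sup>2 * (\<eta> t)\<^sup>2 \<le> 1 / (real t + 1)" if t: "t \<in> {1..T}" for t
  proof -
    have "real t + 1 \<le> \<tau> + 1" using t by (simp add: \<tau>_def)
    also have "\<dots> \<le> 4 * \<tau>\<^sup>2"
    proof -
      have "2 * \<tau> \<le> \<tau>\<^sup>2" unfolding power2_eq_square using \<tau> by (intro mult_right_mono) auto
      with \<tau> show ?thesis by linarith
    qed
    finally have "1 / (4 * \<tau>\<^sup>2) \<le> 1 / (real t + 1)"
      by (intro divide_left_mono) (use \<tau> in auto)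
    with \<eta>_sq[OF t] show ?thesis by linarith
  qed

  \<comment> \<open>Averaging over the permutations\<close>
  have fin: "finite (set_pmf \<P>)"
    and marginal: "\<And>t. t \<in> {1..T} \<Longrightarrow> map_pmf (\<lambda>\<pi>. \<pi> t) \<P> = uniform_permutation n"
    using shuffling_schemes[OF assms(18)] by blast+
  have int: "integrable (measure_pmf \<P>) h" for h :: "_ \<Rightarrow> real"
    by (rule integrable_measure_pmf_finite[OF fin])
  have perm: "\<pi> t permutes {1..n}" if "\<pi> \<in> set_pmf \<P>" "t \<in> {1..T}" for \<pi> t
    using that marginal[of t] set_uniform_permutation[of n] by (metis (mono_tags) imageI mem_Collect_eq set_map_pmf)
  define c where "c t = (real t + 1)\<^sup>2 * (L * (\<eta> t)\<^sup>2 / N ^ 3)" for t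
  have c0: "c t \<ge> 0" for t
    using \<open>L > 0\<close> N by (simp add: c_def)
  have path: "\<tau> * (\<tau> + 2) * (F (?x \<pi>) - F xstar)
      \<le> 2 / \<eta> 1 * (norm (x0 - xstar))\<^sup>2 + (\<Sum>t=1..T. c t * tail_energy n ?a (\<pi> t))"
    if "\<pi> \<in> set_pmf \<P>" for \<pi>
    using nasg_pathwise_bound[of L n f grad F xstar \<gamma> \<eta> T \<pi> x0,
        OF assms(1-6,8,14) \<eta>_pos \<eta>_mono small perm[OF that]]
    by (simp add: \<tau>_def c_def N_def mult.assoc)
  have tail: "measure_pmf.expectation \<P> (\<lambda>\<pi>. tail_energy n ?a (\<pi> t)) \<le> N\<^sup>2 * \<sigma>star\<^sup>2"
    if t: "t \<in> {1..T}" for t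
  proof -
    have "measure_pmf.expectation \<P> (\<lambda>\<pi>. tail_energy n ?a (\<pi> t))
        = measure_pmf.expectation (uniform_permutation n) (tail_energy n ?a)"
      by (simp flip: marginal[OF t])
    also have "\<dots> \<le> real n * (\<Sum>i=1..n. (norm (grad i xstar))\<^sup>2)"
      by (intro expectation_tail_energy_le sum_gradients_at_minimum[where f = f and F = F and z = xstar])
        (use assms in auto)
    also have "\<dots> = N\<^sup>2 * \<sigma>star\<^sup>2"
    proof -
      have "(\<Sum>i=1..n. (norm (grad i xstar))\<^sup>2) = N * \<sigma>star\<^sup>2"
        using N by (simp add: assms(10) N_def)
      then show ?thesis by (simp only: N_def power2_eq_square mult.assoc)
    qed
    finally show ?thesis .
  qed
  let ?S = "measure_pmf.expectation \<P> (\<lambda>\<pi>. F (?x \<pi>) - F xstar)"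
  have "\<tau> * (\<tau> + 2) * ?S = measure_pmf.expectation \<P> (\<lambda>\<pi>. \<tau> * (\<tau> + 2) * (F (?x \<pi>) - F xstar))"
    by simp
  also have "\<dots> \<le> measure_pmf.expectation \<P> (\<lambda>\<pi>. 2 / \<eta> 1 * (norm (x0 - xstar))\<^sup>2
      + (\<Sum>t=1..T. c t * tail_energy n ?a (\<pi> t)))"
    using path by (intro integral_mono_AE int AE_pmfI)
  also have "\<dots> = 2 / \<eta> 1 * (norm (x0 - xstar))\<^sup>2
      + (\<Sum>t=1..T. c t * measure_pmf.expectation \<P> (\<lambda>\<pi>. tail_energy n ?a (\<pi> t)))"
    by (simp add: Bochner_Integration.integral_add int Bochner_Integration.integral_sum)
  \<comment> \<open>Each epoch is replaced by the worst case, using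
    \<open>real t + 1 \<le> \<tau> + 1\<close> and \<open>\<eta>_sq\<close>, so that the summand
    becomes independent of \<open>t\<close>.\<close>
  also have "\<dots> \<le> 2 / \<eta> 1 * (E\<^sup>2 / N) + (\<Sum>t=1..T. (\<tau> + 1)\<^sup>2 * (\<sigma>star\<^sup>2 / (4 * N * L * \<tau>\<^sup>2)))"
  proof (intro add_mono sum_mono mult_left_mono)
    show "(norm (x0 - xstar))\<^sup>2 \<le> E\<^sup>2 / N"
      using power_mono[OF assms(9), of 2] by (simp add: N_def power_divide)
    show "0 \<le> 2 / \<eta> 1" using \<eta>_pos[of 1] by simp
    fix t assume t: "t \<in> {1..T}"
    have "c t * measure_pmf.expectation \<P> (\<lambda>\<pi>. tail_energy n ?a (\<pi> t)) \<le> c t * (N\<^sup>2 * \<sigma>star\<^sup>2)"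
      by (intro mult_left_mono tail t c0)
    also have "\<dots> = (real t + 1)\<^sup>2 * (L\<^sup>2 * (\<eta> t)\<^sup>2 * (\<sigma>star\<^sup>2 / (N * L)))"
      using N \<open>L > 0\<close> by (simp add: c_def power2_eq_square power3_eq_cube)
    also have "\<dots> \<le> (\<tau> + 1)\<^sup>2 * (1 / (4 * \<tau>\<^sup>2) * (\<sigma>star\<^sup>2 / (N * L)))"
      using t N \<open>L > 0\<close> \<eta>_sq[OF t] by (intro mult_mono power_mono) (auto simp: \<tau>_def)
    also have "\<dots> = (\<tau> + 1)\<^sup>2 * (\<sigma>star\<^sup>2 / (4 * N * L * \<tau>\<^sup>2))"
      by (simp add: mult_ac)
    finally show "c t * measure_pmf.expectation \<P> (\<lambda>\<pi>. tail_energy n ?a (\<pi> t))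
        \<le> (\<tau> + 1)\<^sup>2 * (\<sigma>star\<^sup>2 / (4 * N * L * \<tau>\<^sup>2))" .
  qed

  \<comment> \<open>Comparison of the constants\<close>
  also have "\<dots> = 2 * L * E\<^sup>2 * exp 1 * r * \<tau> / N + (\<tau> + 1)\<^sup>2 * (\<sigma>star\<^sup>2 / (4 * N * L * \<tau>))"
    using \<eta>_eq[of 0] \<tau> by (simp add: \<tau>_def[symmetric] power2_eq_square mult_ac)
  also have "\<dots> \<le> \<tau> * (\<tau> + 2) * (2 * L * E\<^sup>2 * exp 1 * r / (N * \<tau>))
      + \<tau> * (\<tau> + 2) * (8 * \<sigma>star\<^sup>2 / (27 * N * L * \<tau>))"
  proof (rule add_mono)
    have "\<tau> * (2 * L * E\<^sup>2 * exp 1 * r / N) \<le> (\<tau> + 2) * (2 * L * E\<^sup>2 * exp 1 * r / N)"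
      using \<tau> r N \<open>L > 0\<close> by (intro mult_right_mono) auto
    then show "2 * L * E\<^sup>2 * exp 1 * r * \<tau> / N \<le> \<tau> * (\<tau> + 2) * (2 * L * E\<^sup>2 * exp 1 * r / (N * \<tau>))"
      using \<tau> by (simp add: mult_ac)
    \<comment> \<open>The ratio of \<open>(\<tau> + 1)\<^sup>2 / 4\<close> to
      \<open>\<tau> * (\<tau> + 2)\<close> decreases in \<tau> and equals \<open>9 / 32\<close> at
      \<open>\<tau> = 2\<close>, which is below \<open>8 / 27\<close>.\<close>
    have "(\<tau> + 1)\<^sup>2 / 4 \<le> \<tau> * (\<tau> + 2) * (8 / 27)"
    proof -
      have "\<tau> * (\<tau> + 2) * (8 / 27) - (\<tau> + 1)\<^sup>2 / 4 = (5 * (\<tau> * \<tau>) + 10 * \<tau> - 27) / 108"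
        by (simp add: power2_eq_square field_simps)
      also have "\<dots> \<ge> 0" using \<tau> mult_mono[of 2 \<tau> 2 \<tau>] by simp
      finally show ?thesis by (simp only: diff_ge_0_iff_ge)
    qed
    moreover define Q where "Q = \<sigma>star\<^sup>2 / (N * L * \<tau>)"
    moreover have "Q \<ge> 0" using \<tau> N \<open>L > 0\<close> by (simp add: Q_def)
    ultimately have "(\<tau> + 1)\<^sup>2 / 4 * Q \<le> \<tau> * (\<tau> + 2) * (8 / 27) * Q"
      by (intro mult_right_mono)
    moreover have "\<sigma>star\<^sup>2 / (4 * N * L * \<tau>) = 1 / 4 * Q" "8 * \<sigma>star\<^sup>2 / (27 * N * L * \<tau>) = 8 / 27 * Q"
      by (simp_all add: Q_def mult.assoc)
    ultimately show "(\<tau> + 1)\<^sup>2 * (\<sigma>star\<^sup>2 / (4 * N * L * \<tau>)) \<le> \<tau> * (\<tau> + 2) * (8 * \<sigma>star\<^sup>2 / (27 * N * L * \<tau>))"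
      by (simp only:)
  qed
  also have "\<dots> = \<tau> * (\<tau> + 2) * (8 * \<sigma>star\<^sup>2 / (27 * N * L * \<tau>) + 2 * L * E\<^sup>2 * exp 1 * r / (N * \<tau>))"
    by (simp only: distrib_left add.commute)
  finally have "?S \<le> 8 * \<sigma>star\<^sup>2 / (27 * N * L * \<tau>) + 2 * L * E\<^sup>2 * exp 1 * r / (N * \<tau>)"
    using \<tau> by (subst (asm) mult_le_cancel_left_pos) auto
  then show ?thesis by (simp add: N_def \<tau>_def r_def)
qed

end
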